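(* Let $\mathbb{D}=\{z\in\mathbb{C}:|z|<1\}$ and let $f=h+\overline{g}$ be a sense-preserving univalent harmonic mapping of $\mathbb{D}$ with $h(z)=z+\sum_{n=2}^\infty a_nz^n$ and $g(z)=\sum_{n=2}^\infty b_nz^n$ (so $f\in\mathcal{S}^0_H$), which is stable convex, i.e. $h+\mu\overline{g}$ is univalent and convex in $\mathbb{D}$ for every $|\mu|=1$. Let $m,p\in\mathbb{N}$, $\omega_m\in\mathcal{B}_m$ and $\omega_p\in\mathcal{B}_p$. Then $$|Df(\omega_m(z))|+M_f(|\omega_p(z)|)\le d\big(f(0),\partial f(\mathbb{D})\big)\quad\text{and}\quad |\mathscr{D}f(\omega_m(z))|+M_f(|\omega_p(z)|)\le d\big(f(0),\partial f(\mathbb{D})\big)$$ both hold for $|z|=r\le r_{2,m,p}$, where $r_{2,m,p}$ is the unique root in $(0,1)$ of $$r^m+r^p+\frac{2r^{2m}-r^{3m}}{(1-r^m)^2}+\frac{r^{2p}}{1-r^p}-\frac12=0.$$ The radius $r_{2,m,p}$ is best possible.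
   Context: For $n\in\mathbb{N}$, $\mathcal{B}_n$ denotes the set of analytic functions $\omega:\mathbb{D}\to\mathbb{C}$ with $|\omega(z)|\le1$ in $\mathbb{D}$, $\omega(0)=\omega'(0)=\cdots=\omega^{(n-1)}(0)=0$ and $\omega^{(n)}(0)\neq0$. For a harmonic $f$, $Df=zf_z-\overline{z}f_{\overline{z}}$ and $\mathscr{D}f=zf_z+\overline{z}f_{\overline{z}}$, and $Df(\omega_m(z))$ means $(Df)(\omega_m(z))$ (similarly for $\mathscr{D}$). For $\rho\in[0,1)$, $M_f(\rho)=\rho+\sum_{n=2}^\infty(|a_n|+|b_n|)\rho^n$. $d(f(0),\partial f(\mathbb{D}))$ is the Euclidean distance from $f(0)$ to the boundary of $f(\mathbb{D})$. "Best possible" means that for every $r>r_{2,m,p}$ there exist such $f,\omega_m,\omega_p$ and $z$ with $|z|=r$ for which the inequality fails. *)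

theory Defs
  imports "HOL-Complex_Analysis.Complex_Analysis"
begin

definition harm :: "(complex \<Rightarrow> complex) \<Rightarrow> (complex \<Rightarrow> complex) \<Rightarrow> complex \<Rightarrow> complex" where
  "harm h g = (\<lambda>z. h z + cnj (g z))"

definition tcoeff :: "(complex \<Rightarrow> complex) \<Rightarrow> nat \<Rightarrow> complex" where
  "tcoeff h n = (deriv ^^ n) h 0 / of_nat (fact n)"

definition in_SH0 :: "(complex \<Rightarrow> complex) \<Rightarrow> (complex \<Rightarrow> complex) \<Rightarrow> bool" where
  "in_SH0 h g \<longleftrightarrow> h holomorphic_on ball 0 1 \<and> g holomorphic_on ball 0 1 \<and>
     h 0 = 0 \<and> deriv h 0 = 1 \<and> g 0 = 0 \<and> deriv g 0 = 0 \<and>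
     (\<forall>z\<in>ball 0 1. norm (deriv g z) < norm (deriv h z)) \<and>
     inj_on (harm h g) (ball 0 1)"

definition stable_convex :: "(complex \<Rightarrow> complex) \<Rightarrow> (complex \<Rightarrow> complex) \<Rightarrow> bool" where
  "stable_convex h g \<longleftrightarrow> (\<forall>\<mu>::complex. norm \<mu> = 1 \<longrightarrow>
     inj_on (\<lambda>z. h z + \<mu> * cnj (g z)) (ball 0 1) \<and>
     convex ((\<lambda>z. h z + \<mu> * cnj (g z)) ` ball 0 1))"

text \<open>Df = z f_z - conj z f_{conj z},  script-D f = z f_z + conj z f_{conj z}, evaluated at w.\<close>
definition Dop :: "(complex \<Rightarrow> complex) \<Rightarrow> (complex \<Rightarrow> complex) \<Rightarrow> complex \<Rightarrow> complex" where
  "Dop h g w = w * deriv h w - cnj w * cnj (deriv g w)"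

definition Dscr :: "(complex \<Rightarrow> complex) \<Rightarrow> (complex \<Rightarrow> complex) \<Rightarrow> complex \<Rightarrow> complex" where
  "Dscr h g w = w * deriv h w + cnj w * cnj (deriv g w)"

definition Mf :: "(complex \<Rightarrow> complex) \<Rightarrow> (complex \<Rightarrow> complex) \<Rightarrow> real \<Rightarrow> real" where
  "Mf h g \<rho> = \<rho> + (\<Sum>n. (norm (tcoeff h (n + 2)) + norm (tcoeff g (n + 2))) * \<rho> ^ (n + 2))"

definition schwarzB :: "nat \<Rightarrow> (complex \<Rightarrow> complex) \<Rightarrow> bool" where
  "schwarzB m \<omega> \<longleftrightarrow> \<omega> holomorphic_on ball 0 1 \<and> (\<forall>z\<in>ball 0 1. norm (\<omega> z) \<le> 1) \<and>
     (\<forall>k<m. (deriv ^^ k) \<omega> 0 = 0) \<and> (deriv ^^ m) \<omega> 0 \<noteq> 0"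

definition bdist :: "(complex \<Rightarrow> complex) \<Rightarrow> (complex \<Rightarrow> complex) \<Rightarrow> real" where
  "bdist h g = infdist (harm h g 0) (frontier (harm h g ` ball 0 1))"

definition radius_eq :: "nat \<Rightarrow> nat \<Rightarrow> real \<Rightarrow> real" where
  "radius_eq m p r = r ^ m + r ^ p + (2 * r ^ (2 * m) - r ^ (3 * m)) / (1 - r ^ m) ^ 2
     + r ^ (2 * p) / (1 - r ^ p) - 1 / 2"

definition r2 :: "nat \<Rightarrow> nat \<Rightarrow> real" where
  "r2 m p = (THE r. 0 < r \<and> r < 1 \<and> radius_eq m p r = 0)"

end

theory Submission
  imports Defs
begin

text \<open>
  Write \<open>f = h + cnj g\<close>. Shearing the convex maps \<open>h + \<mu> cnj g\<close> in every direction shows that all the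
  analytic maps \<open>F = h + \<epsilon> g\<close> with \<open>\<bar>\<epsilon>\<bar> = 1\<close> are convex univalent. Averaging \<open>F\<close> over the \<open>n\<close>-th roots
  of unity and applying the Schwarz lemma to \<open>F\<^sup>-\<^sup>1\<close> of the average bounds the \<open>n\<close>-th coefficient of \<open>F\<close>
  by 1; choosing \<open>\<epsilon>\<close> well gives \<open>\<bar>a\<^sub>n\<bar> + \<bar>b\<^sub>n\<bar> \<le> 1\<close>, hence \<open>\<bar>h' w\<bar> + \<bar>g' w\<bar> \<le> 1 / (1 - \<bar>w\<bar>)\<^sup>2\<close> and
  \<open>M\<^sub>f \<rho> \<le> \<rho> / (1 - \<rho>)\<close>. A supporting line of the image of \<open>f\<close> lies at distance at least \<open>1 / 2\<close> from the
  origin, because \<open>f\<close> agrees in the normal direction with a normalised analytic map. The equation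
  for the radius is \<open>x / (1 - x)\<^sup>2 + y / (1 - y) = 1 / 2\<close> with \<open>x = r\<^sup>m\<close> and \<open>y = r\<^sup>p\<close>, and \<open>z / (1 - z)\<close>
  is extremal.
\<close>

section \<open>Schwarz-type lemmas and coefficients of convex maps\<close>

text \<open>On the circle of radius \<open>\<rho>\<close> the hypothesis bounds \<open>R\<close> by
  \<open>1 / \<rho> ^ n\<close>; the maximum principle carries this inside, and
  \<open>\<rho>\<close> tends to 1. This is the Schwarz lemma after division by
  \<open>z ^ n\<close>.\<close>

lemma norm_le_one_of_norm_power_mult_le_one:
  assumes holR: "R holomorphic_on ball 0 1"
    and le: "\<And>z. z \<in> ball 0 1 \<Longrightarrow> norm (z ^ n * R z) \<le> 1"
    and z: "z \<in> ball 0 (1::real)"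
  shows "norm (R z :: complex) \<le> 1"
proof -
  have bound: "norm (R z) \<le> 1 / \<rho> ^ n" if \<rho>: "norm z < \<rho>" "\<rho> < 1" for \<rho>
  proof (rule maximum_modulus_frontier[of R "cball 0 \<rho>"])
    have pos: "0 < \<rho>" using \<rho>(1) norm_ge_zero[of z] by linarith
    show "R holomorphic_on interior (cball 0 \<rho>)"
      using \<rho> by (auto intro!: holomorphic_on_subset[OF holR])
    show "continuous_on (closure (cball 0 \<rho>)) R"
      using \<rho> by (auto intro!: continuous_on_subset[OF holomorphic_on_imp_continuous_on[OF holR]])
    fix w :: complex assume "w \<in> frontier (cball 0 \<rho>)"
    hence w: "norm w = \<rho>" by (simp add: frontier_cball)
    from le[of w] w \<rho> have "\<rho> ^ n * norm (R w) \<le> 1"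
      by (simp add: norm_mult norm_power)
    with pos show "norm (R w) \<le> 1 / \<rho> ^ n"
      by (simp add: field_simps)
  qed (use \<rho> in auto)
  have lt: "norm z < 1" using z by simp
  have "((\<lambda>\<rho>. 1 / \<rho> ^ n) \<longlongrightarrow> 1 / 1 ^ n) (at_left (1::real))"
    by (intro tendsto_intros) auto
  moreover have "\<forall>\<^sub>F \<rho> in at_left (1::real). norm (R z) \<le> 1 / \<rho> ^ n"
    using eventually_at_left_real[OF lt] by eventually_elim (use bound in auto)
  ultimately show ?thesis
    using tendsto_lowerbound[of "\<lambda>\<rho>. 1 / \<rho> ^ n" "1 / 1 ^ n" "at_left (1::real)" "norm (R z)"] by simp
qed

text \<open>Stated for an arbitrary convergent series so that it serves Taylor series and
  root-of-unity averages alike.\<close>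

lemma power_series_factor:
  fixes c :: "nat \<Rightarrow> complex"
  assumes sums: "\<And>z. z \<in> ball 0 1 \<Longrightarrow> (\<lambda>k. c k * z ^ k) sums P z"
    and zero: "\<And>k. k < n \<Longrightarrow> c k = 0"
  obtains Q where "Q holomorphic_on ball 0 1" "\<And>z. z \<in> ball 0 1 \<Longrightarrow> P z = z ^ n * Q z" "Q 0 = c n"
proof
  define Q where "Q = (\<lambda>z. \<Sum>k. c (k + n) * z ^ k)"
  have sm: "summable (\<lambda>k. c (k + n) * z ^ k)" if z: "z \<in> ball 0 1" for z
  proof (cases "z = 0")
    case False
    from sums_summable[OF sums[OF z]] have "summable (\<lambda>k. c (k + n) * z ^ (k + n))"
      by (rule summable_ignore_initial_segment)
    hence "summable (\<lambda>k. (c (k + n) * z ^ (k + n)) * (1 / z ^ n))"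
      by (rule summable_mult2)
    thus ?thesis using False by (simp add: power_add)
  qed (use summable_0_powser[of "\<lambda>k. c (k + n)"] in simp)
  hence Qsums: "(\<lambda>k. c (k + n) * z ^ k) sums Q z" if "z \<in> ball 0 1" for z
    using that unfolding Q_def by (simp add: summable_sums)
  show "Q holomorphic_on ball 0 1"
    by (rule power_series_holomorphic[of 0 1 "\<lambda>k. c (k + n)"]) (use Qsums in auto)
  show "Q 0 = c n"
    unfolding Q_def using powser_zero[of "\<lambda>k. c (k + n)"] by simp
  fix z :: complex assume z: "z \<in> ball 0 1"
  have "(\<lambda>k. z ^ n * (c (k + n) * z ^ k)) sums (z ^ n * Q z)"
    by (rule sums_mult[OF Qsums[OF z]])
  hence "(\<lambda>k. c (k + n) * z ^ (k + n)) sums (z ^ n * Q z)"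
    by (simp add: power_add mult_ac)
  hence "(\<lambda>k. c k * z ^ k) sums (z ^ n * Q z)"
    using zero by (subst (asm) sums_iff_shift) simp
  thus "P z = z ^ n * Q z" using sums[OF z] sums_unique2 by blast
qed

lemma tcoeff_sums:
  assumes "f holomorphic_on ball 0 1" "z \<in> ball 0 1"
  shows "(\<lambda>n. tcoeff f n * z ^ n) sums f z"
  using holomorphic_power_series[OF assms] by (simp add: tcoeff_def)

lemma schwarzB_norm_le:
  assumes B: "schwarzB n \<omega>" and z: "z \<in> ball 0 1"
  shows "norm (\<omega> z) \<le> norm z ^ n"
proof -
  from B have hol: "\<omega> holomorphic_on ball 0 1" and le: "\<And>z. z \<in> ball 0 1 \<Longrightarrow> norm (\<omega> z) \<le> 1"
    by (auto simp: schwarzB_def)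
  have "tcoeff \<omega> k = 0" if "k < n" for k
    using B that by (auto simp: schwarzB_def tcoeff_def)
  then obtain Q where Q: "Q holomorphic_on ball 0 1" "\<And>z. z \<in> ball 0 1 \<Longrightarrow> \<omega> z = z ^ n * Q z"
    using power_series_factor[of "tcoeff \<omega>" \<omega> n] tcoeff_sums[OF hol] by blast
  have "norm (Q z) \<le> 1"
    using norm_le_one_of_norm_power_mult_le_one[OF Q(1) _ z, of n] Q(2) le by metis
  thus ?thesis
    using Q(2)[OF z] mult_left_mono[of "norm (Q z)" 1 "norm z ^ n"] by (simp add: norm_mult norm_power)
qed

text \<open>The Moebius map sending \<open>w\<close> to \<open>w / (2 * d - w)\<close> takes the
  half-plane \<open>Re w \<le> d\<close> into the closed unit disc, fixes 0 and has derivative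
  \<open>1 / (2 * d)\<close> there; the Schwarz lemma applies to its composition with
  \<open>\<phi>\<close>.\<close>

lemma norm_deriv_le_of_Re_le:
  assumes hol: "\<phi> holomorphic_on ball 0 1" and \<phi>0: "\<phi> 0 = 0" and d: "0 < d"
    and Re: "\<And>z. z \<in> ball 0 1 \<Longrightarrow> Re (\<phi> z) \<le> d"
  shows "norm (deriv \<phi> 0) \<le> 2 * d"
proof -
  have nz: "2 * of_real d - \<phi> z \<noteq> 0" if "z \<in> ball 0 1" for z
    using Re[OF that] d by (auto simp: complex_eq_iff)
  define \<psi> where "\<psi> = (\<lambda>z. \<phi> z / (2 * of_real d - \<phi> z))"
  have hol\<psi>: "\<psi> holomorphic_on ball 0 1"
    unfolding \<psi>_def using nz by (intro holomorphic_intros hol) auto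
  have le1: "norm (\<psi> z) \<le> 1" if z: "z \<in> ball 0 1" for z
  proof -
    \<comment> \<open>The difference of the two squares is
      \<open>4 * d * (d - Re (\<phi> z))\<close>.\<close>
    have "(norm (\<phi> z))\<^sup>2 \<le> (norm (2 * of_real d - \<phi> z))\<^sup>2"
      using mult_left_mono[OF Re[OF z], of d] d
      by (simp add: cmod_power2 power2_diff) (simp add: power2_eq_square algebra_simps)
    hence "norm (\<phi> z) \<le> norm (2 * of_real d - \<phi> z)"
      by (rule power2_le_imp_le) simp
    thus ?thesis using nz[OF z] by (simp add: \<psi>_def norm_divide divide_le_eq_1)
  qed
  have \<phi>': "(\<phi> has_field_derivative deriv \<phi> 0) (at 0)"
    using holomorphic_derivI[OF hol, of 0] by simp
  have "(\<psi> has_field_derivative (deriv \<phi> 0 / (2 * of_real d))) (at 0)"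
    unfolding \<psi>_def using d \<phi>0
    by (auto intro!: derivative_eq_intros \<phi>' simp: field_simps)
  hence "tcoeff \<psi> 1 = deriv \<phi> 0 / (2 * of_real d)"
    by (simp add: tcoeff_def DERIV_imp_deriv)
  moreover have "tcoeff \<psi> k = 0" if "k < 1" for k
    using that \<phi>0 by (simp add: tcoeff_def \<psi>_def)
  then obtain Q where Q: "Q holomorphic_on ball 0 1" "\<And>z. z \<in> ball 0 1 \<Longrightarrow> \<psi> z = z ^ 1 * Q z"
      "Q 0 = tcoeff \<psi> 1"
    using power_series_factor[of "tcoeff \<psi>" \<psi> 1] tcoeff_sums[OF hol\<psi>] by blast
  have "norm (Q 0) \<le> 1"
    using norm_le_one_of_norm_power_mult_le_one[OF Q(1), of 1 0] Q(2) le1 by auto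
  ultimately show ?thesis
    using Q(3) d by (simp add: norm_divide norm_mult)
qed

lemma norm_tcoeff_le_of_convex_image:
  assumes hol: "F holomorphic_on ball 0 1" and inj: "inj_on F (ball 0 1)"
    and conv: "convex (F ` ball 0 1)" and F0: "F 0 = 0" and F1: "deriv F 0 = 1" and n: "n \<ge> 1"
  shows "norm (tcoeff F n) \<le> 1"
proof -
  define \<omega> where "\<omega> = cis (2 * pi / real n)"
  have n\<omega>: "\<omega> ^ n = 1" and [simp]: "norm \<omega> = 1"
    using n Complex.DeMoivre[of "2 * pi / real n" n] by (auto simp: \<omega>_def)
  have \<omega>ne: "\<omega> ^ k \<noteq> 1" if "0 < k" "k < n" for k
  proof
    assume "\<omega> ^ k = 1"
    hence "cis (real k * (2 * pi / real n)) = 1" by (simp add: \<omega>_def Complex.DeMoivre)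
    hence "cos (2 * pi * (real k / real n)) = 1"
      by (simp add: complex_eq_iff mult_ac)
    then obtain i :: int where "2 * pi * (real k / real n) = of_int i * 2 * pi"
      using cos_one_2pi_int by auto
    hence "(real k / real n) * (2 * pi) = of_int i * (2 * pi)" by (simp only: mult_ac)
    hence "real k / real n = of_int i" unfolding mult_cancel_right using pi_gt_zero by simp
    moreover have "0 < real k / real n" "real k / real n < 1" using that by auto
    ultimately show False by auto
  qed
  define P where "P = (\<lambda>z. \<Sum>j<n. (1 / real n) *\<^sub>R F (\<omega> ^ j * z))"
  \<comment> \<open>The averaged factor is 1 if \<open>n\<close> divides \<open>k\<close> and 0
    otherwise, as \<open>\<omega>\<close> is a primitive root. Below \<open>n\<close> only
    \<open>k = 0\<close> escapes, and there \<open>F 0 = 0\<close> helps.\<close>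
  define c where "c = (\<lambda>k. tcoeff F k * ((\<Sum>j<n. (\<omega> ^ k) ^ j) / of_nat n))"
  have in_disc: "\<omega> ^ j * z \<in> ball 0 1" if "z \<in> ball 0 1" for j z
    using that by (simp add: norm_mult norm_power)
  have P_in: "P z \<in> F ` ball 0 1" if "z \<in> ball 0 1" for z
    unfolding P_def by (rule convex_sum[OF _ conv]) (use n in_disc[OF that] in auto)
  have "(\<lambda>k. c k * z ^ k) sums P z" if z: "z \<in> ball 0 1" for z
  proof -
    have "(\<lambda>k. \<Sum>j<n. (1 / real n) *\<^sub>R (tcoeff F k * (\<omega> ^ j * z) ^ k)) sums P z"
      unfolding P_def by (intro sums_sum sums_scaleR_right tcoeff_sums hol in_disc z)
    also have "(\<lambda>k. \<Sum>j<n. (1 / real n) *\<^sub>R (tcoeff F k * (\<omega> ^ j * z) ^ k)) = (\<lambda>k. c k * z ^ k)"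
      by (simp add: c_def scaleR_conv_of_real sum_distrib_left sum_distrib_right sum_divide_distrib
          power_mult_distrib flip: power_mult) (simp add: mult_ac)
    finally show ?thesis .
  qed
  moreover have "c k = 0" if "k < n" for k
  proof (cases "k = 0")
    case False
    have "(\<Sum>j<n. (\<omega> ^ k) ^ j) = ((\<omega> ^ k) ^ n - 1) / (\<omega> ^ k - 1)"
      using \<omega>ne[of k] False that by (intro geometric_sum) auto
    also have "(\<omega> ^ k) ^ n = 1"
      using n\<omega> by (metis mult.commute power_mult power_one)
    finally show ?thesis by (simp add: c_def)
  qed (simp add: c_def tcoeff_def F0)
  ultimately obtain Q where Q: "Q holomorphic_on ball 0 1" "\<And>z. z \<in> ball 0 1 \<Longrightarrow> P z = z ^ n * Q z"
      "Q 0 = c n"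
    using power_series_factor[of c P n] by blast
  have cn: "c n = tcoeff F n" using n by (simp add: c_def n\<omega>)
  obtain S where S: "S holomorphic_on F ` ball 0 1"
      "\<And>z. z \<in> ball 0 1 \<Longrightarrow> deriv F z * deriv S (F z) = 1" "\<And>z. z \<in> ball 0 1 \<Longrightarrow> S (F z) = z"
    using holomorphic_has_inverse[OF hol open_ball inj] by blast
  have S0: "S 0 = 0" "deriv S 0 = 1" using S(2,3)[of 0] F0 F1 by auto
  have opn: "open (F ` ball 0 1)" using open_mapping_thm3[OF hol open_ball inj] .
  \<comment> \<open>\<open>K\<close> is \<open>S w / w\<close> with the singularity at 0 removed.
    Then \<open>S (P z) = z ^ n * (Q z * K (P z))\<close>, and the cofactor of \<open>z ^ n\<close>
    takes the value \<open>tcoeff F n\<close> at 0 because \<open>deriv S 0 = 1\<close>.\<close>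
  define K where "K = (\<lambda>w. if w = 0 then deriv S 0 else S w / w)"
  have K: "K holomorphic_on F ` ball 0 1"
    by (rule pole_theorem_open_0[OF S(1) opn, of 0]) (auto simp: K_def S0)
  have SK: "S w = w * K w" for w by (simp add: K_def S0)
  have "(\<lambda>z. z ^ n * Q z) holomorphic_on ball 0 1" by (intro holomorphic_intros Q(1))
  hence "P holomorphic_on ball 0 1" by (rule holomorphic_transform) (simp add: Q(2))
  hence "(\<lambda>z. K (P z)) holomorphic_on ball 0 1"
    using holomorphic_on_compose_gen[OF _ K, of P "ball 0 1"] P_in unfolding o_def by blast
  hence R: "(\<lambda>z. Q z * K (P z)) holomorphic_on ball 0 1" by (intro holomorphic_intros Q(1))
  have "norm (z ^ n * (Q z * K (P z))) \<le> 1" if z: "z \<in> ball 0 1" for z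
  proof -
    have "z ^ n * (Q z * K (P z)) = S (P z)" using Q(2)[OF z] SK by simp
    moreover have "S (P z) \<in> ball 0 1" using P_in[OF z] S(3) by auto
    ultimately show ?thesis by simp
  qed
  from norm_le_one_of_norm_power_mult_le_one[OF R this, of 0]
  have "norm (Q 0 * K (P 0)) \<le> 1" by simp
  moreover have "P 0 = 0" by (simp add: P_def F0)
  ultimately show ?thesis by (simp add: Q(3) cn K_def S0)
qed

section \<open>Shearing\<close>

text \<open>Equal end values would produce an extremum at an interior point, but near such a point
  local injectivity forces strict monotonicity.\<close>

lemma locally_inj_imp_endpoints_neq:
  fixes q :: "real \<Rightarrow> real"
  assumes cont: "continuous_on {0..1} q"
    and loc: "\<And>t. t \<in> {0..1} \<Longrightarrow> \<exists>\<delta>>0. inj_on q ({0..1} \<inter> ball t \<delta>)"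
  shows "q 0 \<noteq> q 1"
proof
  assume eq: "q 0 = q 1"
  have no_extremum: False
    if t: "0 < t" "t < 1" and ext: "(\<forall>s\<in>{0..1}. q s \<le> q t) \<or> (\<forall>s\<in>{0..1}. q t \<le> q s)" for t
  proof -
    obtain \<delta> where \<delta>: "\<delta> > 0" "inj_on q ({0..1} \<inter> ball t \<delta>)" using loc[of t] t by auto
    define \<eta> where "\<eta> = min (\<delta> / 2) (min t (1 - t))"
    have \<eta>: "\<eta> > 0" "\<eta> < \<delta>" "\<eta> \<le> t" "\<eta> \<le> 1 - t" using t \<delta>(1) by (auto simp: \<eta>_def)
    have sub: "{t - \<eta>..t + \<eta>} \<subseteq> {0..1} \<inter> ball t \<delta>"
      using \<eta> by (auto simp: dist_real_def)
    have "q (t - \<eta>) < q t \<and> q t < q (t + \<eta>) \<or> q (t + \<eta>) < q t \<and> q t < q (t - \<eta>)"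
      using \<eta> by (intro continuous_inj_imp_mono continuous_on_subset[OF cont] inj_on_subset[OF \<delta>(2)])
        (use sub in auto)
    moreover have "t - \<eta> \<in> {0..1}" "t + \<eta> \<in> {0..1}" using \<eta> by auto
    ultimately show False using ext by (meson not_less)
  qed
  obtain a where a: "a \<in> {0..1}" "\<And>s. s \<in> {0..1} \<Longrightarrow> q s \<le> q a"
    using continuous_attains_sup[OF _ _ cont] by auto
  obtain b where b: "b \<in> {0..1}" "\<And>s. s \<in> {0..1} \<Longrightarrow> q b \<le> q s"
    using continuous_attains_inf[OF _ _ cont] by auto
  have "a \<in> {0, 1}" using no_extremum[of a] a by force
  moreover have "b \<in> {0, 1}" using no_extremum[of b] b by force
  ultimately have "q a = q b" using eq by auto
  \<comment> \<open>Both extrema lie at endpoints, so \<open>q\<close> is constant and the midpoint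
    is an extremum as well.\<close>
  hence "q (1 / 2) \<le> q s" if "s \<in> {0..1}" for s using a(2)[of "1/2"] b(2)[OF that] by simp
  thus False using no_extremum[of "1 / 2"] by auto
qed

lemma cnj_mult_self: "norm u = 1 \<Longrightarrow> cnj u * u = 1"
  by (metis complex_norm_square mult.commute of_real_1 power_one)

text \<open>The path is the preimage under \<open>k\<close> of the segment from \<open>k z1\<close>
  to \<open>k z2\<close>. Along it \<open>Im (cnj u * k z)\<close> is affine, so equal end values
  make it constant. As \<open>F\<close> shares this coordinate, it moves on a line of direction
  \<open>u\<close>.\<close>

lemma shear_path:
  fixes k F :: "complex \<Rightarrow> complex"
  assumes contk: "continuous_on (ball 0 1) k" and injk: "inj_on k (ball 0 1)"
    and convk: "convex (k ` ball 0 1)" and contF: "continuous_on (ball 0 1) F"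
    and Im: "\<And>z. z \<in> ball 0 1 \<Longrightarrow> Im (cnj u * F z) = Im (cnj u * k z)"
    and z: "z1 \<in> ball 0 1" "z2 \<in> ball 0 1" and eq: "Im (cnj u * F z1) = Im (cnj u * F z2)"
  obtains \<gamma> where "continuous_on {0..1::real} \<gamma>" "\<gamma> ` {0..1} \<subseteq> ball 0 1" "\<gamma> 0 = z1" "\<gamma> 1 = z2"
    "z1 \<noteq> z2 \<Longrightarrow> inj_on \<gamma> {0..1}"
    "\<And>t. t \<in> {0..1} \<Longrightarrow> Im (cnj u * F (\<gamma> t)) = Im (cnj u * F z1)"
proof -
  obtain S where hom: "homeomorphism (ball 0 1) (k ` ball 0 1) k S"
    using invariance_of_domain_homeomorphism[OF open_ball contk _ injk] by auto
  define \<gamma> where "\<gamma> = S \<circ> linepath (k z1) (k z2)"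
  have line: "linepath (k z1) (k z2) t \<in> k ` ball 0 1" if "t \<in> {0..1}" for t
    using that z convk
    by (metis closed_segment_subset image_eqI linepath_in_path subsetD)
  have k\<gamma>: "k (\<gamma> t) = linepath (k z1) (k z2) t" "\<gamma> t \<in> ball 0 1" if "t \<in> {0..1}" for t
    using line[OF that] hom by (auto simp: homeomorphism_def \<gamma>_def)
  show ?thesis
  proof
    show "continuous_on {0..1} \<gamma>" unfolding \<gamma>_def
      by (intro continuous_on_compose continuous_on_linepath continuous_on_subset[OF homeomorphism_cont2[OF hom]])
        (use line in auto)
    show "\<gamma> ` {0..1} \<subseteq> ball 0 1" using k\<gamma> by auto
    show "\<gamma> 0 = z1" "\<gamma> 1 = z2"
      using z hom by (auto simp: \<gamma>_def linepath_0' linepath_1' homeomorphism_def)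
    show "inj_on \<gamma> {0..1}" if "z1 \<noteq> z2"
    proof (rule inj_onI)
      fix s t :: real assume st: "s \<in> {0..1}" "t \<in> {0..1}" "\<gamma> s = \<gamma> t"
      have "k z1 \<noteq> k z2" using injk z that by (auto dest: inj_onD)
      moreover have "linepath (k z1) (k z2) s = linepath (k z1) (k z2) t"
        using k\<gamma>(1)[OF st(1)] k\<gamma>(1)[OF st(2)] st(3) by simp
      ultimately show "s = t" using inj_on_linepath[of "k z1" "k z2"] st(1,2) by (auto dest: inj_onD)
    qed
    fix t :: real assume t: "t \<in> {0..1}"
    have "Im (cnj u * F (\<gamma> t)) = Im (cnj u * linepath (k z1) (k z2) t)"
      using Im[OF k\<gamma>(2)[OF t]] k\<gamma>(1)[OF t] by simp
    also have "\<dots> = (1 - t) * Im (cnj u * k z1) + t * Im (cnj u * k z2)"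
      by (simp add: linepath_def algebra_simps)
    also have "\<dots> = (1 - t) * Im (cnj u * F z1) + t * Im (cnj u * F z1)"
      unfolding Im[OF z(1), symmetric] Im[OF z(2), symmetric] eq ..
    also have "\<dots> = Im (cnj u * F z1)"
      by (simp only: left_diff_distrib mult_1 diff_add_cancel)
    finally show "Im (cnj u * F (\<gamma> t)) = Im (cnj u * F z1)" .
  qed
qed

text \<open>The path \<open>k\<^sup>-\<^sup>1\<close> of a segment is mapped by \<open>F\<close> into a line, where local injectivity forces
  monotonicity.\<close>

lemma shear_inj_on:
  fixes k F :: "complex \<Rightarrow> complex"
  assumes contk: "continuous_on (ball 0 1) k" and injk: "inj_on k (ball 0 1)"
    and convk: "convex (k ` ball 0 1)" and holF: "F holomorphic_on ball 0 1"
    and F': "\<And>z. z \<in> ball 0 1 \<Longrightarrow> deriv F z \<noteq> 0" and u: "u \<noteq> 0"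
    and Im: "\<And>z. z \<in> ball 0 1 \<Longrightarrow> Im (cnj u * F z) = Im (cnj u * k z)"
  shows "inj_on F (ball 0 1)"
proof (rule inj_onI, rule ccontr)
  fix z1 z2 :: complex assume z: "z1 \<in> ball 0 1" "z2 \<in> ball 0 1" "F z1 = F z2" "z1 \<noteq> z2"
  note contF = holomorphic_on_imp_continuous_on[OF holF]
  obtain \<gamma> where \<gamma>: "continuous_on {0..1::real} \<gamma>" "\<gamma> ` {0..1} \<subseteq> ball 0 1" "\<gamma> 0 = z1" "\<gamma> 1 = z2"
    "inj_on \<gamma> {0..1}" "\<And>t. t \<in> {0..1} \<Longrightarrow> Im (cnj u * F (\<gamma> t)) = Im (cnj u * F z1)"
    using shear_path[OF contk injk convk contF Im z(1,2)] z(3,4) by (metis (no_types, lifting))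
  \<comment> \<open>Along the path \<open>q\<close> is the only coordinate of
    \<open>cnj u * F\<close> that varies, so local injectivity of \<open>F\<close> passes to
    \<open>q\<close>, whereas \<open>F z1 = F z2\<close> makes the end values of \<open>q\<close>
    equal.\<close>
  define q where "q = (\<lambda>t. Re (cnj u * F (\<gamma> t)))"
  have "q 0 \<noteq> q 1"
  proof (rule locally_inj_imp_endpoints_neq)
    show "continuous_on {0..1} q" unfolding q_def
      by (intro continuous_intros continuous_on_compose2[OF contF \<gamma>(1,2)])
    fix t :: real assume t: "t \<in> {0..1}"
    have \<gamma>t: "\<gamma> t \<in> ball 0 1" using \<gamma>(2) t by blast
    obtain r where r: "r > 0" "inj_on F (ball (\<gamma> t) r)"
      using has_complex_derivative_locally_injective[OF holF \<gamma>t open_ball F'[OF \<gamma>t]] by auto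
    obtain \<delta> where \<delta>: "\<delta> > 0" "\<And>s. s \<in> {0..1} \<Longrightarrow> dist s t < \<delta> \<Longrightarrow> dist (\<gamma> s) (\<gamma> t) < r"
      using \<gamma>(1) t r(1) unfolding continuous_on_iff by meson
    have "inj_on q ({0..1} \<inter> ball t \<delta>)"
    proof (rule inj_onI)
      fix s s' assume s: "s \<in> {0..1} \<inter> ball t \<delta>" "s' \<in> {0..1} \<inter> ball t \<delta>" "q s = q s'"
      hence "cnj u * F (\<gamma> s) = cnj u * F (\<gamma> s')"
        using \<gamma>(6)[of s] \<gamma>(6)[of s'] by (intro complex_eqI) (auto simp: q_def)
      hence "F (\<gamma> s) = F (\<gamma> s')" using u by simp
      moreover have "\<gamma> s \<in> ball (\<gamma> t) r" "\<gamma> s' \<in> ball (\<gamma> t) r"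
        using \<delta>(2)[of s] \<delta>(2)[of s'] s by (auto simp: dist_commute)
      ultimately have "\<gamma> s = \<gamma> s'" using r(2) by (auto dest: inj_onD)
      thus "s = s'" using \<gamma>(5) s by (auto dest: inj_onD)
    qed
    thus "\<exists>\<delta>>0. inj_on q ({0..1} \<inter> ball t \<delta>)" using \<delta>(1) by blast
  qed
  thus False using z(3) by (simp add: q_def \<gamma>)
qed

text \<open>Here \<open>k\<close> may change with the direction: each chord of the image is treated
  with the shear along that chord. The resulting path moves on the line of the chord, so the
  intermediate value theorem reaches every point of the chord.\<close>

lemma shear_convex_image:
  fixes F :: "complex \<Rightarrow> complex"
  assumes contF: "continuous_on (ball 0 1) F"
    and k: "\<And>u. norm u = 1 \<Longrightarrow> \<exists>k. continuous_on (ball 0 1) k \<and> inj_on k (ball 0 1) \<and>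
      convex (k ` ball 0 1) \<and> (\<forall>z\<in>ball 0 1. Im (cnj u * F z) = Im (cnj u * k z))"
  shows "convex (F ` ball 0 1)"
  unfolding convex_contains_segment
proof clarify
  fix z1 z2 w :: complex
  assume z: "z1 \<in> ball 0 1" "z2 \<in> ball 0 1" and w: "w \<in> closed_segment (F z1) (F z2)"
  show "w \<in> F ` ball 0 1"
  proof (cases "F z1 = F z2")
    case True
    thus ?thesis using w z by auto
  next
    case False
    define u where "u = sgn (F z2 - F z1)"
    define l where "l = norm (F z2 - F z1)"
    have l: "l > 0" using False by (simp add: l_def)
    have u: "norm u = 1" using False by (simp add: u_def norm_sgn)
    have u_cancel: "cnj u * (x * u) = x" for x
      using cnj_mult_self[OF u] by (metis mult.left_commute mult.right_neutral)
    have F2: "F z2 = F z1 + of_real l * u"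
      using False by (simp add: u_def l_def sgn_div_norm scaleR_conv_of_real flip: mult.assoc)
    obtain k where k': "continuous_on (ball 0 1) k" "inj_on k (ball 0 1)" "convex (k ` ball 0 1)"
      "\<And>z. z \<in> ball 0 1 \<Longrightarrow> Im (cnj u * F z) = Im (cnj u * k z)"
      using k[OF u] by blast
    have c2: "cnj u * F z2 = cnj u * F z1 + of_real l"
      by (simp add: F2 distrib_left u_cancel)
    have eq: "Im (cnj u * F z1) = Im (cnj u * F z2)" unfolding c2 by simp
    obtain \<gamma> where \<gamma>: "continuous_on {0..1::real} \<gamma>" "\<gamma> ` {0..1} \<subseteq> ball 0 1" "\<gamma> 0 = z1" "\<gamma> 1 = z2"
      "\<And>t. t \<in> {0..1} \<Longrightarrow> Im (cnj u * F (\<gamma> t)) = Im (cnj u * F z1)"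
      using shear_path[OF k'(1,2,3) contF k'(4) z eq] by (metis (no_types, lifting))
    obtain s where s: "0 \<le> s" "s \<le> 1" "w = F z1 + of_real (s * l) * u"
      using w by (auto simp: in_segment F2 scaleR_conv_of_real algebra_simps)
    have "\<exists>t\<ge>0. t \<le> 1 \<and> Re (cnj u * F (\<gamma> t)) = Re (cnj u * F z1) + s * l"
    proof (rule IVT')
      show "Re (cnj u * F (\<gamma> 0)) \<le> Re (cnj u * F z1) + s * l" using s l by (simp add: \<gamma>)
      show "Re (cnj u * F z1) + s * l \<le> Re (cnj u * F (\<gamma> 1))"
        unfolding \<gamma> c2 using s l by simp
      show "continuous_on {0..1} (\<lambda>t. Re (cnj u * F (\<gamma> t)))"
        by (intro continuous_intros continuous_on_compose2[OF contF \<gamma>(1,2)])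
    qed simp
    then obtain t where t: "t \<in> {0..1}" "Re (cnj u * F (\<gamma> t)) = Re (cnj u * F z1) + s * l" by auto
    have "cnj u * F (\<gamma> t) = cnj u * F z1 + of_real (s * l)"
      using t(2) \<gamma>(5)[OF t(1)] by (intro complex_eqI) auto
    also have "\<dots> = cnj u * w" by (simp only: s(3) distrib_left u_cancel)
    finally have "w = F (\<gamma> t)" using u by auto
    thus ?thesis using \<gamma>(2) t(1) by blast
  qed
qed

section \<open>Stable convex maps\<close>

lemma geometric_tail_sums:
  fixes \<rho> :: real
  assumes "0 \<le> \<rho>" "\<rho> < 1"
  shows "(\<lambda>n. \<rho> ^ (n + 2)) sums (\<rho>\<^sup>2 / (1 - \<rho>))"
  using sums_mult[OF geometric_sums[of \<rho>], of "\<rho>\<^sup>2"] assms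
  by (simp add: power_add mult_ac power2_eq_square)

text \<open>Rotating \<open>b\<close> into the direction of \<open>a\<close> makes the triangle
  inequality an equality. This turns bounds valid for every \<open>h + \<epsilon> g\<close> into
  bounds for sums of moduli.\<close>

lemma aligned_phase:
  obtains \<epsilon> :: complex where "norm \<epsilon> = 1" "norm (a + \<epsilon> * b) = norm a + norm b"
proof (cases "a = 0 \<or> b = 0")
  case True
  thus ?thesis using that[of 1] by auto
next
  case False
  define \<epsilon> where "\<epsilon> = sgn a / sgn b"
  have \<epsilon>: "norm \<epsilon> = 1" using False by (simp add: \<epsilon>_def norm_divide norm_sgn)
  have "\<epsilon> * b = of_real (norm b) * sgn a"
    using False by (simp add: \<epsilon>_def sgn_div_norm scaleR_conv_of_real field_simps)
  moreover have "a = of_real (norm a) * sgn a"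
    using False by (simp add: sgn_div_norm scaleR_conv_of_real field_simps)
  ultimately have "a + \<epsilon> * b = of_real (norm a + norm b) * sgn a"
    by (metis distrib_right of_real_add)
  hence "norm (a + \<epsilon> * b) = norm a + norm b"
    using False by (simp add: norm_mult norm_sgn flip: of_real_add)
  thus ?thesis using that \<epsilon> by blast
qed

locale stable_convex_map =
  fixes h g :: "complex \<Rightarrow> complex"
  assumes SH0: "in_SH0 h g" and stable: "stable_convex h g"
begin

lemma holomorphic: "h holomorphic_on ball 0 1" "g holomorphic_on ball 0 1"
  and at_0: "h 0 = 0" "deriv h 0 = 1" "g 0 = 0" "deriv g 0 = 0"
  and dilatation: "z \<in> ball 0 1 \<Longrightarrow> norm (deriv g z) < norm (deriv h z)"
  and inj_harm: "inj_on (harm h g) (ball 0 1)"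
  using SH0 by (auto simp: in_SH0_def)

lemma continuous_on_disc: "continuous_on (ball 0 1) h" "continuous_on (ball 0 1) g"
  by (simp_all add: holomorphic holomorphic_on_imp_continuous_on)

lemma has_field_derivative_disc:
  assumes "z \<in> ball 0 1"
  shows "(h has_field_derivative deriv h z) (at z)" "(g has_field_derivative deriv g z) (at z)"
  using assms holomorphic holomorphic_derivI[OF _ open_ball] by blast+

lemma deriv_combination:
  assumes "z \<in> ball 0 1"
  shows "deriv (\<lambda>z. h z + \<epsilon> * g z) z = deriv h z + \<epsilon> * deriv g z"
  by (rule DERIV_imp_deriv) (auto intro!: derivative_eq_intros has_field_derivative_disc assms)

lemma holomorphic_combination: "(\<lambda>z. h z + \<epsilon> * g z) holomorphic_on ball 0 1"
  by (intro holomorphic_intros holomorphic)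

text \<open>Strictness of the dilatation bound rules out cancellation; the local injectivity
  required for shearing comes from here.\<close>

lemma deriv_combination_neq_0:
  assumes "norm \<epsilon> = 1" "z \<in> ball 0 1"
  shows "deriv (\<lambda>z. h z + \<epsilon> * g z) z \<noteq> 0"
proof
  assume "deriv (\<lambda>z. h z + \<epsilon> * g z) z = 0"
  hence "deriv h z = - \<epsilon> * deriv g z"
    by (simp add: deriv_combination[OF assms(2)] add_eq_0_iff)
  hence "norm (deriv h z) = norm (deriv g z)" using assms(1) by (simp add: norm_mult)
  thus False using dilatation[OF assms(2)] by simp
qed

text \<open>Stability enters here: each pair of a phase \<open>\<epsilon>\<close> and a direction
  \<open>u\<close> selects its own member of the convex family.\<close>

lemma harmonic_shear:
  assumes \<epsilon>: "norm \<epsilon> = 1" and u: "norm u = 1"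
  shows "\<exists>k. continuous_on (ball 0 1) k \<and> inj_on k (ball 0 1) \<and> convex (k ` ball 0 1) \<and>
    (\<forall>z\<in>ball 0 1. Im (cnj u * (h z + \<epsilon> * g z)) = Im (cnj u * k z))"
proof -
  \<comment> \<open>chosen so that \<open>cnj u * (\<epsilon> * g z - \<mu> * cnj (g z))\<close> is real\<close>
  define \<mu> where "\<mu> = - (u * u * cnj \<epsilon>)"
  have \<mu>: "norm \<mu> = 1" using \<epsilon> u by (simp add: \<mu>_def norm_mult)
  note uu = cnj_mult_self[OF u]
  have "cnj u * \<mu> = - (cnj u * u) * (u * cnj \<epsilon>)" by (simp add: \<mu>_def mult_ac)
  hence \<mu>': "cnj u * \<mu> = - cnj (cnj u * \<epsilon>)" by (simp add: uu)
  have "Im (cnj u * (h z + \<epsilon> * g z)) = Im (cnj u * (h z + \<mu> * cnj (g z)))" for z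
  proof -
    have "cnj u * (\<mu> * cnj (g z)) = - cnj ((cnj u * \<epsilon>) * g z)"
      unfolding mult.assoc[symmetric] \<mu>' by simp
    hence "Im (cnj u * (\<mu> * cnj (g z))) = Im ((cnj u * \<epsilon>) * g z)" by (simp only: uminus_complex.sel cnj.sel minus_minus)
    thus ?thesis by (simp only: distrib_left plus_complex.sel mult.assoc)
  qed
  moreover have "continuous_on (ball 0 1) (\<lambda>z. h z + \<mu> * cnj (g z))"
    by (intro continuous_intros continuous_on_disc)
  ultimately show ?thesis
    using stable \<mu> unfolding stable_convex_def by (intro exI[of _ "\<lambda>z. h z + \<mu> * cnj (g z)"]) auto
qed

text \<open>Shearing in the single direction \<open>u = 1\<close> settles injectivity, while
  convexity draws on all directions.\<close>

lemma inj_on_combination: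
  assumes \<epsilon>: "norm \<epsilon> = 1"
  shows "inj_on (\<lambda>z. h z + \<epsilon> * g z) (ball 0 1)"
proof -
  obtain k where "continuous_on (ball 0 1) k" "inj_on k (ball 0 1)" "convex (k ` ball 0 1)"
      "\<And>z. z \<in> ball 0 1 \<Longrightarrow> Im (cnj 1 * (h z + \<epsilon> * g z)) = Im (cnj 1 * k z)"
    using harmonic_shear[OF \<epsilon>, of 1] by auto
  thus ?thesis
    using shear_inj_on[OF _ _ _ holomorphic_combination, of k \<epsilon> 1] deriv_combination_neq_0[OF \<epsilon>]
    by (metis (no_types, lifting) one_neq_zero)
qed

lemma convex_combination_image:
  assumes \<epsilon>: "norm \<epsilon> = 1"
  shows "convex ((\<lambda>z. h z + \<epsilon> * g z) ` ball 0 1)"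
  by (intro shear_convex_image harmonic_shear \<epsilon> holomorphic_on_imp_continuous_on holomorphic_combination)

lemma tcoeff_combination: "tcoeff (\<lambda>z. h z + \<epsilon> * g z) n = tcoeff h n + \<epsilon> * tcoeff g n"
proof -
  have "(deriv ^^ n) (\<lambda>z. h z + \<epsilon> * g z) 0 = (deriv ^^ n) h 0 + (deriv ^^ n) (\<lambda>z. \<epsilon> * g z) 0"
    by (rule higher_deriv_add[of _ "ball 0 1"]) (auto intro!: holomorphic_intros holomorphic)
  also have "(deriv ^^ n) (\<lambda>z. \<epsilon> * g z) 0 = \<epsilon> * (deriv ^^ n) g 0"
    by (rule higher_deriv_cmult[of _ "ball 0 1"]) (auto intro!: holomorphic)
  finally show ?thesis by (simp add: tcoeff_def add_divide_distrib)
qed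

lemma norm_tcoeff_combination_le:
  assumes "norm \<epsilon> = 1" "n \<ge> 1"
  shows "norm (tcoeff (\<lambda>z. h z + \<epsilon> * g z) n) \<le> 1"
  by (rule norm_tcoeff_le_of_convex_image)
    (use assms in \<open>simp_all add: holomorphic_combination inj_on_combination convex_combination_image
      deriv_combination at_0\<close>)

text \<open>The phase may depend on \<open>n\<close>, since the coefficient bound holds for every
  unimodular \<open>\<epsilon>\<close>.\<close>

lemma norm_tcoeff_add_le:
  assumes "n \<ge> 1"
  shows "norm (tcoeff h n) + norm (tcoeff g n) \<le> 1"
  using norm_tcoeff_combination_le[OF _ assms] tcoeff_combination aligned_phase by metis

lemma Mf_le:
  assumes \<rho>: "0 \<le> \<rho>" "\<rho> < 1"
  shows "Mf h g \<rho> \<le> \<rho> / (1 - \<rho>)"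
proof -
  note geo = geometric_tail_sums[OF \<rho>]
  have le: "(norm (tcoeff h (n + 2)) + norm (tcoeff g (n + 2))) * \<rho> ^ (n + 2) \<le> \<rho> ^ (n + 2)" for n
    using mult_right_mono[OF norm_tcoeff_add_le[of "n + 2"], of "\<rho> ^ (n + 2)"] \<rho> by simp
  have "summable (\<lambda>n. (norm (tcoeff h (n + 2)) + norm (tcoeff g (n + 2))) * \<rho> ^ (n + 2))"
    by (rule summable_comparison_test'[OF sums_summable[OF geo], of 0]) (use le \<rho> in \<open>simp add: abs_mult\<close>)
  from suminf_le[OF le this sums_summable[OF geo]]
  have "Mf h g \<rho> \<le> \<rho> + \<rho>\<^sup>2 / (1 - \<rho>)"
    using sums_unique[OF geo] by (simp add: Mf_def)
  also have "\<dots> = \<rho> / (1 - \<rho>)" using \<rho> by (simp add: field_simps power2_eq_square)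
  finally show ?thesis .
qed

text \<open>The phase is aligned at the point \<open>w\<close>; the series of \<open>deriv F\<close>
  is then majorised termwise by the differentiated geometric series in
  \<open>norm w\<close>.\<close>

lemma norm_deriv_add_le:
  assumes w: "w \<in> ball 0 1"
  shows "norm (deriv h w) + norm (deriv g w) \<le> 1 / (1 - norm w)\<^sup>2"
proof -
  obtain \<epsilon> where \<epsilon>: "norm \<epsilon> = 1"
    "norm (deriv h w + \<epsilon> * deriv g w) = norm (deriv h w) + norm (deriv g w)"
    by (rule aligned_phase)
  define F where "F = (\<lambda>z. h z + \<epsilon> * g z)"
  have hol: "F holomorphic_on ball 0 1" unfolding F_def by (rule holomorphic_combination)
  have coeff: "tcoeff (deriv F) n = of_nat (Suc n) * tcoeff F (Suc n)" for n
    by (simp only: tcoeff_def funpow_Suc_right o_def fact_Suc of_nat_mult of_nat_id)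
      (simp del: of_nat_Suc)
  have "deriv F holomorphic_on ball 0 1" by (rule holomorphic_deriv[OF hol open_ball])
  from tcoeff_sums[OF this w] have ser: "(\<lambda>n. of_nat (Suc n) * tcoeff F (Suc n) * w ^ n) sums deriv F w"
    unfolding coeff .
  have geo: "(\<lambda>n. of_nat (Suc n) * norm w ^ n) sums (1 / (1 - norm w)\<^sup>2)"
    by (rule geometric_deriv_sums) (use w in simp)
  have le: "norm (of_nat (Suc n) * tcoeff F (Suc n) * w ^ n) \<le> of_nat (Suc n) * norm w ^ n" for n
  proof -
    have "norm (tcoeff F (Suc n)) \<le> 1" unfolding F_def by (rule norm_tcoeff_combination_le[OF \<epsilon>(1)]) simp
    hence "(real (Suc n) * norm w ^ n) * norm (tcoeff F (Suc n)) \<le> (real (Suc n) * norm w ^ n) * 1"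
      by (intro mult_left_mono) auto
    thus ?thesis by (simp add: norm_mult norm_power mult_ac del: of_nat_Suc)
  qed
  have "norm (deriv F w) \<le> 1 / (1 - norm w)\<^sup>2"
    using norm_suminf_le[OF le sums_summable[OF geo]] sums_unique[OF ser] sums_unique[OF geo] by simp
  thus ?thesis using \<epsilon>(2) by (simp add: F_def deriv_combination[OF w])
qed

text \<open>If the moduli agreed at some point, a unimodular \<open>\<epsilon>\<close> would give
  \<open>h + \<epsilon> g\<close> the same value there and at \<open>w\<close>, against injectivity.
  Hence their order is the same everywhere, and the dilatation decides it at
  \<open>w\<close>.\<close>

lemma norm_diff_g_less:
  assumes z: "z \<in> ball 0 1" "w \<in> ball 0 1" "z \<noteq> w"
  shows "norm (g z - g w) < norm (h z - h w)"
proof -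
  \<comment> \<open>The difference quotient, continued by the derivative at \<open>w\<close>, is
    holomorphic, so the sign can be read off at \<open>w\<close> itself and carried over the
    connected disc.\<close>
  define quot where "quot f = (\<lambda>x. if x = w then deriv f w else (f x - f w) / (x - w))" for f :: "complex \<Rightarrow> complex"
  have hol_quot: "quot f holomorphic_on ball 0 1" if "f holomorphic_on ball 0 1" for f
  proof -
    have "(f has_field_derivative deriv f w) (at w)"
      using holomorphic_derivI[OF that open_ball z(2)] .
    hence "((\<lambda>x. f x - f w) has_field_derivative deriv f w - 0) (at w)"
      by (intro DERIV_diff DERIV_const)
    hence deriv: "deriv (\<lambda>x. f x - f w) w = deriv f w" by (simp add: DERIV_imp_deriv)
    have "(\<lambda>x. f x - f w) holomorphic_on ball 0 1" by (intro holomorphic_intros that)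
    thus ?thesis
      by (rule pole_theorem_open_0[where a = w]) (auto simp: quot_def deriv)
  qed
  have cont: "continuous_on (ball 0 1) (\<lambda>x. norm (quot h x) - norm (quot g x))"
    by (intro continuous_intros holomorphic_on_imp_continuous_on hol_quot holomorphic)
  define D where "D = (\<lambda>x. norm (quot h x) - norm (quot g x))"
  have D0: "D x \<noteq> 0" if x: "x \<in> ball 0 1" for x
  proof (cases "x = w")
    case True
    thus ?thesis using dilatation[OF x] by (simp add: D_def quot_def)
  next
    case False
    show ?thesis
    proof
      assume "D x = 0"
      hence eq: "norm (h x - h w) = norm (g x - g w)"
        using False by (simp add: D_def quot_def norm_divide)
      obtain \<epsilon> where \<epsilon>: "norm \<epsilon> = 1" "h x - h w + \<epsilon> * (g x - g w) = 0"
      proof (cases "g x = g w")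
        case True
        thus ?thesis using that[of 1] eq by simp
      next
        case False
        thus ?thesis using that[of "- (h x - h w) / (g x - g w)"] eq
          by (simp add: norm_divide norm_minus_commute)
      qed
      hence "h x + \<epsilon> * g x = h w + \<epsilon> * g w" by (simp add: algebra_simps)
      thus False using inj_onD[OF inj_on_combination[OF \<epsilon>(1)]] x z(2) False by blast
    qed
  qed
  have "connected (D ` ball 0 1)" unfolding D_def
    by (intro connected_continuous_image cont) simp
  moreover have "D w > 0" using dilatation[OF z(2)] by (simp add: D_def quot_def)
  ultimately have "D z > 0"
    using connectedD_interval[of "D ` ball 0 1" "D z" "D w" 0] D0[of z] D0 z
    by (metis (no_types, lifting) image_iff image_eqI less_eq_real_def linorder_not_less)
  thus ?thesis using z(3) by (simp add: D_def quot_def norm_divide divide_strict_right_mono field_simps)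
qed

section \<open>The image of the harmonic map and its frontier\<close>

lemma continuous_on_harm: "continuous_on (ball 0 1) (harm h g)"
  unfolding harm_def by (intro continuous_intros continuous_on_disc)

lemma open_harm_image: "open (harm h g ` ball 0 1)"
  by (rule invariance_of_domain[OF continuous_on_harm open_ball inj_harm])

lemma convex_harm_image: "convex (harm h g ` ball 0 1)"
proof -
  have "harm h g = (\<lambda>z. h z + 1 * cnj (g z))" by (simp add: harm_def)
  thus ?thesis using stable unfolding stable_convex_def by (metis norm_one)
qed

text \<open>If \<open>f\<close> were onto the plane, then \<open>h\<close>, which dominates \<open>f\<close> in the sense
  \<open>\<bar>f z - f w\<bar> \<le> 2 \<bar>h z - h w\<bar>\<close>, would have closed image and hence also be onto; its inverse would
  contradict Liouville's theorem.\<close>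

lemma harm_image_neq_UNIV: "harm h g ` ball 0 1 \<noteq> UNIV"
proof
  assume onto: "harm h g ` ball 0 1 = UNIV"
  have expand: "norm (harm h g z - harm h g w) \<le> 2 * norm (h z - h w)"
    if "z \<in> ball 0 1" "w \<in> ball 0 1" for z w
  proof (cases "z = w")
    case False
    have "norm (harm h g z - harm h g w) = norm ((h z - h w) + cnj (g z - g w))"
      by (simp add: harm_def algebra_simps)
    also have "\<dots> \<le> norm (h z - h w) + norm (g z - g w)"
      using norm_triangle_ineq[of "h z - h w" "cnj (g z - g w)"] by (simp only: complex_mod_cnj)
    finally show ?thesis using norm_diff_g_less[OF that False] by simp
  qed simp
  have injh: "inj_on h (ball 0 1)"
    using norm_diff_g_less by (fastforce intro: inj_onI)
  obtain S where S: "homeomorphism (ball 0 1) UNIV (harm h g) S"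
    using invariance_of_domain_homeomorphism[OF open_ball continuous_on_harm _ inj_harm] onto by auto
  \<comment> \<open>If \<open>h (z n)\<close> is Cauchy, so is \<open>harm h g (z n)\<close> by
    \<open>expand\<close>; it converges in the plane, and the globally defined continuous inverse
    \<open>S\<close> brings the limit back into the disc.\<close>
  have "complete (h ` ball 0 1)"
    unfolding complete_def
  proof safe
    fix x assume x: "\<forall>n. x n \<in> h ` ball 0 1" and "Cauchy x"
    from x have "\<forall>n::nat. \<exists>w. w \<in> ball 0 1 \<and> x n = h w" by blast
    from choice[OF this] obtain z where z: "\<And>n. z n \<in> ball 0 1" "\<And>n. x n = h (z n)" by auto
    have "Cauchy (\<lambda>n. harm h g (z n))"
    proof (rule CauchyI)
      fix e :: real assume "e > 0"
      then obtain M where "\<And>m n. m \<ge> M \<Longrightarrow> n \<ge> M \<Longrightarrow> norm (x m - x n) < e / 2"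
        using CauchyD[OF \<open>Cauchy x\<close>, of "e / 2"] by auto
      hence "norm (harm h g (z m) - harm h g (z n)) < e" if "m \<ge> M" "n \<ge> M" for m n
        using expand[OF z(1)[of m] z(1)[of n]] that z(2) by fastforce
      thus "\<exists>M. \<forall>m\<ge>M. \<forall>n\<ge>M. norm (harm h g (z m) - harm h g (z n)) < e" by blast
    qed
    then obtain l where "(\<lambda>n. harm h g (z n)) \<longlonglongrightarrow> l"
      using Cauchy_convergent convergentD by blast
    moreover have "isCont S l"
      using homeomorphism_cont2[OF S] by (simp add: continuous_on_eq_continuous_at)
    ultimately have "(\<lambda>n. S (harm h g (z n))) \<longlonglongrightarrow> S l" by (rule isCont_tendsto_compose[rotated])
    moreover have "S (harm h g (z n)) = z n" for n using S z(1) by (simp add: homeomorphism_def)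
    ultimately have "z \<longlonglongrightarrow> S l" by simp
    moreover have Sl: "S l \<in> ball 0 1" using S by (auto simp: homeomorphism_def)
    ultimately have "(\<lambda>n. h (z n)) \<longlonglongrightarrow> h (S l)"
      using continuous_on_disc(1) z(1) by (intro continuous_on_tendsto_compose[OF continuous_on_disc(1)]) auto
    thus "\<exists>l\<in>h ` ball 0 1. x \<longlonglongrightarrow> l" using Sl z(2) by (metis (no_types) ext imageI)
  qed
  hence "closed (h ` ball 0 1)" by (rule complete_imp_closed)
  moreover have "open (h ` ball 0 1)"
    by (rule open_mapping_thm3[OF holomorphic(1) open_ball injh])
  ultimately have "h ` ball 0 1 = {} \<or> h ` ball 0 1 = UNIV"
    by (intro iffD1[OF clopen] conjI)
  hence UN: "h ` ball 0 1 = UNIV" by simp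
  obtain T where T: "T holomorphic_on h ` ball 0 1" "\<And>z. z \<in> ball 0 1 \<Longrightarrow> T (h z) = z"
    by (rule holomorphic_has_inverse[OF holomorphic(1) open_ball injh], rule that)
  have "T w \<in> ball 0 1" for w
  proof -
    have "w \<in> h ` ball 0 1" by (simp only: UN UNIV_I)
    then obtain z where "w = h z" "z \<in> ball 0 1" by (rule imageE)
    thus ?thesis using T(2) by simp
  qed
  hence "range T \<subseteq> ball 0 1" by blast
  hence "bounded (range T)" by (rule bounded_subset[OF bounded_ball])
  hence "T constant_on UNIV" using Liouville_theorem[OF T(1)[unfolded UN]] by simp
  then obtain c where c: "\<And>z. T z = c" unfolding constant_on_def by blast
  show False using c[of "h 0"] c[of "h (1/2)"] T(2)[of 0] T(2)[of "1/2"] by simp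
qed

text \<open>On a supporting half-plane with outer normal \<open>u\<close>, the harmonic map \<open>h + cnj g\<close> has the same
  real part in direction \<open>u\<close> as the analytic map \<open>h + u\<^sup>2 g\<close>.\<close>

lemma half_le_norm_frontier:
  assumes \<zeta>: "\<zeta> \<in> frontier (harm h g ` ball 0 1)"
  shows "1 / 2 \<le> norm \<zeta>"
proof -
  have notin: "\<zeta> \<notin> harm h g ` ball 0 1"
    using \<zeta> open_harm_image by (simp add: frontier_def interior_open)
  have "convex ((\<lambda>x. x - \<zeta>) ` harm h g ` ball 0 1)"
    by (rule convex_translation_subtract[OF convex_harm_image])
  moreover have "0 \<notin> (\<lambda>x. x - \<zeta>) ` harm h g ` ball 0 1" using notin by auto
  ultimately obtain a where a: "a \<noteq> 0" "\<And>x. x \<in> harm h g ` ball 0 1 \<Longrightarrow> 0 \<le> a \<bullet> (x - \<zeta>)"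
    using separating_hyperplane_set_0 by (metis (no_types, lifting) imageI)
  \<comment> \<open>\<open>a\<close> points into the image, so the outer unit normal has the
    opposite sign; \<open>d\<close> below is the signed distance of the supporting line from the
    origin.\<close>
  define u where "u = - sgn a"
  have u: "norm u = 1" using a(1) by (simp add: u_def norm_sgn)
  note uu = cnj_mult_self[OF u]
  have inner: "Re (cnj u * x) = u \<bullet> x" for x by (simp add: inner_complex_def)
  define d where "d = u \<bullet> \<zeta>"
  have le: "u \<bullet> x \<le> d" if "x \<in> harm h g ` ball 0 1" for x
    using a(2)[OF that] a(1)
    by (simp add: u_def d_def sgn_div_norm inner_diff_right divide_right_mono field_simps)
  have f0: "harm h g 0 = 0" by (simp add: harm_def at_0)
  have "0 \<in> harm h g ` ball 0 1" using f0 by (metis centre_in_ball imageI zero_less_one)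
  then obtain e where e: "e > 0" "cball 0 e \<subseteq> harm h g ` ball 0 1"
    using open_harm_image open_contains_cball by blast
  \<comment> \<open>An image point in direction \<open>u\<close> from the origin makes
    \<open>d\<close> strictly positive, as the half-plane estimate presupposes.\<close>
  have "of_real e * u \<in> cball 0 e" using e(1) u by (simp add: norm_mult)
  hence "u \<bullet> (of_real e * u) \<le> d" using e(2) le by blast
  moreover have "u \<bullet> (of_real e * u) = e"
    using u by (simp add: scaleR_conv_of_real[symmetric] dot_square_norm)
  ultimately have d: "d > 0" using e(1) by simp
  define \<phi> where "\<phi> = (\<lambda>z. cnj u * (h z + (u * u) * g z))"
  have hol: "\<phi> holomorphic_on ball 0 1"
    unfolding \<phi>_def by (intro holomorphic_intros holomorphic)
  have "(\<phi> has_field_derivative cnj u * (deriv h 0 + (u * u) * deriv g 0)) (at 0)"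
    unfolding \<phi>_def by (auto intro!: derivative_eq_intros has_field_derivative_disc)
  hence \<phi>': "deriv \<phi> 0 = cnj u" using at_0 by (simp add: DERIV_imp_deriv)
  have Re: "Re (\<phi> z) \<le> d" if z: "z \<in> ball 0 1" for z
  proof -
    \<comment> \<open>\<open>cnj u * u = 1\<close> leaves \<open>u * g z\<close>, whose real part is
      that of its conjugate \<open>cnj u * cnj (g z)\<close>.\<close>
    have "\<phi> z = cnj u * h z + (cnj u * u) * (u * g z)" by (simp add: \<phi>_def algebra_simps)
    hence "Re (\<phi> z) = Re (cnj u * h z) + Re (cnj (u * g z))" by (simp only: uu) simp
    also have "\<dots> = Re (cnj u * harm h g z)" by (simp add: harm_def algebra_simps)
    also have "\<dots> \<le> d" unfolding inner using le z by blast
    finally show ?thesis .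
  qed
  have "norm (deriv \<phi> 0) \<le> 2 * d"
    using norm_deriv_le_of_Re_le[OF hol _ d Re] by (simp add: \<phi>_def at_0)
  hence "1 / 2 \<le> d" using u by (simp add: \<phi>')
  also have "d \<le> norm \<zeta>" unfolding d_def using norm_cauchy_schwarz[of u \<zeta>] u by simp
  finally show ?thesis .
qed

lemma bdist_ge_half: "1 / 2 \<le> bdist h g"
proof -
  \<comment> \<open>\<open>infdist\<close> to an empty set is 0 by convention, so nonemptiness of
    the frontier has to be secured first.\<close>
  have "frontier (harm h g ` ball 0 1) \<noteq> {}"
    using harm_image_neq_UNIV by (auto simp: frontier_eq_empty)
  thus ?thesis unfolding bdist_def infdist_notempty[OF \<open>frontier _ \<noteq> {}\<close>]
    using half_le_norm_frontier by (intro cINF_greatest) (auto simp: harm_def at_0)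
qed

end

section \<open>The radius and the extremal map\<close>

text \<open>With \<open>x = r ^ m\<close> and \<open>y = r ^ p\<close>, the fractions in the radius
  equation are the tails, from second order on, of the series of \<open>x / (1 - x)\<^sup>2\<close>
  and \<open>y / (1 - y)\<close>; adding the leading terms completes them.\<close>

lemma radius_eq_alt:
  assumes "m \<ge> 1" "p \<ge> 1" "0 \<le> r" "r < 1"
  shows "radius_eq m p r = r ^ m / (1 - r ^ m)\<^sup>2 + r ^ p / (1 - r ^ p) - 1 / 2"
proof -
  define x y where "x = r ^ m" and "y = r ^ p"
  have ne: "1 - x \<noteq> 0" "1 - y \<noteq> 0"
    using assms power_less_one_iff[of r m] power_less_one_iff[of r p] by (auto simp: x_def y_def)
  have "r ^ (2 * m) = x\<^sup>2" "r ^ (3 * m) = x ^ 3" "r ^ (2 * p) = y\<^sup>2"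
    by (simp_all add: x_def y_def mult.commute flip: power_mult)
  hence eq: "radius_eq m p r = (x + (2 * x\<^sup>2 - x ^ 3) / (1 - x)\<^sup>2) + (y + y\<^sup>2 / (1 - y)) - 1 / 2"
    by (simp add: radius_eq_def flip: x_def y_def)
  have "x + (2 * x\<^sup>2 - x ^ 3) / (1 - x)\<^sup>2 = x / (1 - x)\<^sup>2"
  proof -
    have "x * (1 - x)\<^sup>2 + (2 * x\<^sup>2 - x ^ 3) = x"
      by (simp add: algebra_simps power2_eq_square power3_eq_cube)
    moreover have "x + (2 * x\<^sup>2 - x ^ 3) / (1 - x)\<^sup>2 = (x * (1 - x)\<^sup>2 + (2 * x\<^sup>2 - x ^ 3)) / (1 - x)\<^sup>2"
      using ne by (simp add: add_divide_distrib)
    ultimately show ?thesis by (simp only:)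
  qed
  moreover have "y + y\<^sup>2 / (1 - y) = y / (1 - y)"
    using ne by (simp add: field_simps power2_eq_square)
  ultimately show ?thesis unfolding eq by (simp add: x_def y_def)
qed

lemma div_one_minus_power_mono:
  fixes x y :: real
  assumes "0 \<le> x" "x \<le> y" "y < 1"
  shows "x / (1 - x) ^ k \<le> y / (1 - y) ^ k"
  using assms by (intro frac_le power_mono zero_less_power) auto

lemma radius_eq_strict_mono:
  assumes "m \<ge> 1" "p \<ge> 1" "0 \<le> r" "r < s" "s < 1"
  shows "radius_eq m p r < radius_eq m p s"
proof -
  have lt: "r ^ m < s ^ m" "r ^ p < s ^ p" "s ^ m < 1" "s ^ p < 1"
    using assms by (auto intro!: power_strict_mono simp: power_less_one_iff)
  have "r ^ m / (1 - r ^ m)\<^sup>2 \<le> s ^ m / (1 - s ^ m)\<^sup>2"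
    using lt assms by (intro div_one_minus_power_mono) auto
  moreover have "r ^ p / (1 - r ^ p) < s ^ p / (1 - s ^ p)"
    using lt assms by (intro frac_less) auto
  ultimately show ?thesis using assms by (simp add: radius_eq_alt)
qed

lemma ex1_radius_eq:
  assumes mp: "m \<ge> 1" "p \<ge> 1"
  shows "\<exists>!r. 0 < r \<and> r < 1 \<and> radius_eq m p r = 0"
proof -
  \<comment> \<open>At \<open>R\<close> the second fraction equals 1, which already exceeds 1 / 2,
    so a sign change occurs in \<open>{0..R}\<close>, away from the pole at 1.\<close>
  define R where "R = root p (1 / 2)"
  have R: "0 < R" "R < 1" "R ^ p = 1 / 2"
    using mp real_root_lt_1_iff[of p "1/2"] real_root_pow_pos2[of p "1/2"] by (auto simp: R_def)
  have Rm: "R ^ m < 1" using R mp by (simp add: power_less_one_iff)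
  have "\<exists>r\<ge>0. r \<le> R \<and> r ^ m / (1 - r ^ m)\<^sup>2 + r ^ p / (1 - r ^ p) - 1 / 2 = 0"
  proof (rule IVT')
    show "0 ^ m / (1 - 0 ^ m)\<^sup>2 + 0 ^ p / (1 - 0 ^ p) - 1 / 2 \<le> (0::real)"
      using mp by (simp add: power_0_left)
    show "0 \<le> R ^ m / (1 - R ^ m)\<^sup>2 + R ^ p / (1 - R ^ p) - 1 / 2"
      unfolding R(3) using R by simp
    have "r ^ m \<noteq> 1" "r ^ p \<noteq> 1" if "r \<in> {0..R}" for r
      using that R mp power_less_one_iff[of r m] power_less_one_iff[of r p] by auto
    thus "continuous_on {0..R} (\<lambda>r. r ^ m / (1 - r ^ m)\<^sup>2 + r ^ p / (1 - r ^ p) - 1 / 2)"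
      by (intro continuous_intros) auto
  qed (use R in simp)
  then obtain r where r: "0 \<le> r" "r \<le> R" "radius_eq m p r = 0"
    using radius_eq_alt[OF mp] R by force
  have "r \<noteq> 0" using r(3) mp by (auto simp: radius_eq_alt power_0_left)
  hence r01: "0 < r" "r < 1" using r R by auto
  moreover have "s = r" if "0 < s" "s < 1" "radius_eq m p s = 0" for s
    using radius_eq_strict_mono[OF mp, of r s] radius_eq_strict_mono[OF mp, of s r] that r r01
    by (cases r s rule: linorder_cases) auto
  ultimately show ?thesis using r(3) by blast
qed

lemma r2_root:
  assumes "m \<ge> 1" "p \<ge> 1"
  shows "0 < r2 m p" "r2 m p < 1" "radius_eq m p (r2 m p) = 0"
  using theI'[OF ex1_radius_eq[OF assms]] by (simp_all add: r2_def)

section \<open>The inequalities within the radius\<close>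

context stable_convex_map
begin

text \<open>The triangle inequality treats both operators alike, whatever the sign between their
  terms. The Schwarz lemma and monotonicity replace the moduli of \<open>\<omega>m z\<close> and
  \<open>\<omega>p z\<close> by powers of the radius, at which the two bounds add up to exactly 1 /
  2.\<close>

lemma Dop_Dscr_Mf_le:
  assumes mp: "m \<ge> 1" "p \<ge> 1" and \<omega>: "schwarzB m \<omega>m" "schwarzB p \<omega>p" and z: "norm z \<le> r2 m p"
  shows "norm (Dop h g (\<omega>m z)) + Mf h g (norm (\<omega>p z)) \<le> 1 / 2" (is ?D)
    and "norm (Dscr h g (\<omega>m z)) + Mf h g (norm (\<omega>p z)) \<le> 1 / 2" (is ?S)
proof -
  note r = r2_root[OF mp]
  define x y where "x = r2 m p ^ m" and "y = r2 m p ^ p"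
  have xy: "x < 1" "y < 1" using r mp by (simp_all add: x_def y_def power_less_one_iff)
  have zb: "z \<in> ball 0 1" using z r(2) by simp
  have wm: "norm (\<omega>m z) \<le> x" and wp: "norm (\<omega>p z) \<le> y"
    unfolding x_def y_def using schwarzB_norm_le[OF \<omega>(1) zb] schwarzB_norm_le[OF \<omega>(2) zb] z
    by (meson norm_ge_zero order_trans power_mono)+
  have "Mf h g (norm (\<omega>p z)) \<le> norm (\<omega>p z) / (1 - norm (\<omega>p z))"
    by (rule Mf_le) (use wp xy in auto)
  also have "\<dots> \<le> y / (1 - y)"
    using div_one_minus_power_mono[of "norm (\<omega>p z)" y 1] wp xy by simp
  finally have M: "Mf h g (norm (\<omega>p z)) \<le> y / (1 - y)" .
  define w where "w = \<omega>m z"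
  have w: "w \<in> ball 0 1" using wm xy by (simp add: w_def)
  have "norm w * (norm (deriv h w) + norm (deriv g w)) \<le> norm w * (1 / (1 - norm w)\<^sup>2)"
    by (intro mult_left_mono norm_deriv_add_le w) simp
  also have "\<dots> \<le> x / (1 - x)\<^sup>2"
    using div_one_minus_power_mono[of "norm w" x 2] wm xy by (simp add: w_def)
  finally have le: "norm w * (norm (deriv h w) + norm (deriv g w)) \<le> x / (1 - x)\<^sup>2" .
  have D: "norm (Dop h g w) \<le> norm w * (norm (deriv h w) + norm (deriv g w))"
    unfolding Dop_def by (rule norm_triangle_ineq4[THEN order_trans]) (simp add: norm_mult distrib_left)
  have S: "norm (Dscr h g w) \<le> norm w * (norm (deriv h w) + norm (deriv g w))"
    unfolding Dscr_def by (rule norm_triangle_ineq[THEN order_trans]) (simp add: norm_mult distrib_left)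
  have "x / (1 - x)\<^sup>2 + y / (1 - y) = 1 / 2"
    using radius_eq_alt[OF mp, of "r2 m p"] r by (simp add: x_def y_def)
  thus ?D ?S using M le D S unfolding w_def by linarith+
qed

end

section \<open>The half-plane map and sharpness\<close>

definition half_plane_map :: "complex \<Rightarrow> complex" where
  "half_plane_map z = z / (1 - z)"

lemma one_minus_neq_0: "z \<in> ball 0 1 \<Longrightarrow> 1 - z \<noteq> (0::complex)"
  by auto

lemma half_plane_map_inj_on: "inj_on half_plane_map (ball 0 1)"
proof (rule inj_onI)
  fix z w :: complex assume "z \<in> ball 0 1" "w \<in> ball 0 1" "half_plane_map z = half_plane_map w"
  thus "z = w" using one_minus_neq_0[of z] one_minus_neq_0[of w]
    by (simp add: half_plane_map_def field_simps)
qed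

text \<open>The inverse \<open>w / (1 + w)\<close> has modulus below 1 exactly when \<open>w\<close>
  is nearer to 0 than to -1; the perpendicular bisector of these two points bounds the
  half-plane.\<close>

lemma half_plane_map_image: "half_plane_map ` ball 0 1 = {w. - 1 / 2 < Re w}"
proof -
  have cancel: "1 + half_plane_map z = 1 / (1 - z)" if "z \<in> ball 0 1" for z
    using one_minus_neq_0[OF that] by (simp add: half_plane_map_def field_simps)
  have norm_iff: "norm w < norm (1 + w) \<longleftrightarrow> - 1 / 2 < Re w" for w :: complex
  proof -
    have "norm w < norm (1 + w) \<longleftrightarrow> (norm w)\<^sup>2 < (norm (1 + w))\<^sup>2"
      by (auto intro: power_strict_mono dest: power_less_imp_less_base)
    also have "\<dots> \<longleftrightarrow> - 1 / 2 < Re w" unfolding cmod_power2 by (auto simp: power2_eq_square algebra_simps)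
    finally show ?thesis .
  qed
  show ?thesis
  proof (intro set_eqI iffI)
    fix w assume "w \<in> half_plane_map ` ball 0 1"
    then obtain z where z: "z \<in> ball 0 1" "w = half_plane_map z" by auto
    have "norm w < norm (1 + w)"
      using z one_minus_neq_0[OF z(1)] unfolding z(2) cancel[OF z(1)]
      by (simp add: half_plane_map_def norm_divide divide_strict_right_mono)
    thus "w \<in> {w. - 1 / 2 < Re w}" by (simp add: norm_iff)
  next
    fix w assume "w \<in> {w. - 1 / 2 < Re w}"
    hence lt: "norm w < norm (1 + w)" by (simp add: norm_iff)
    hence nz: "1 + w \<noteq> 0" using norm_ge_zero[of w] by (metis norm_zero not_less)
    have "w = half_plane_map (w / (1 + w))" using nz by (simp add: half_plane_map_def field_simps)
    moreover have "w / (1 + w) \<in> ball 0 1" using lt nz by (simp add: norm_divide)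
    ultimately show "w \<in> half_plane_map ` ball 0 1" by blast
  qed
qed

lemma half_plane_map_has_field_derivative:
  assumes "z \<in> ball 0 1"
  shows "(half_plane_map has_field_derivative 1 / (1 - z)\<^sup>2) (at z)"
  unfolding half_plane_map_def[abs_def] using one_minus_neq_0[OF assms]
  by (auto intro!: derivative_eq_intros simp: power2_eq_square)

lemma half_plane_map_deriv: "z \<in> ball 0 1 \<Longrightarrow> deriv half_plane_map z = 1 / (1 - z)\<^sup>2"
  by (rule DERIV_imp_deriv[OF half_plane_map_has_field_derivative])

lemma half_plane_map_holomorphic: "half_plane_map holomorphic_on ball 0 1"
  unfolding half_plane_map_def[abs_def] using one_minus_neq_0 by (intro holomorphic_intros) auto

lemma half_plane_map_in_SH0: "in_SH0 half_plane_map (\<lambda>z. 0)"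
  using half_plane_map_holomorphic half_plane_map_inj_on one_minus_neq_0
  by (auto simp: in_SH0_def half_plane_map_deriv harm_def half_plane_map_def[of 0])

lemma half_plane_map_stable_convex: "stable_convex half_plane_map (\<lambda>z. 0)"
  using half_plane_map_inj_on half_plane_map_image
  by (auto simp: stable_convex_def convex_halfspace_Re_gt)

text \<open>Sharpness asks only for an upper bound, so exhibiting the frontier point -1/2 is
  enough.\<close>

lemma half_plane_map_bdist: "bdist half_plane_map (\<lambda>z. 0) \<le> 1 / 2"
proof -
  define H where "H = {w::complex. - 1 / 2 < Re w}"
  have "- 1 / 2 \<in> closure H"
    unfolding closure_approachable
  proof (intro allI impI)
    fix e :: real assume "e > 0"
    thus "\<exists>y\<in>H. dist y (- 1 / 2) < e"
      by (intro bexI[of _ "of_real (e / 2 - 1 / 2)"]) (auto simp: H_def dist_norm)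
  qed
  moreover have "- 1 / 2 \<notin> interior H" using interior_subset[of H] by (auto simp: H_def)
  ultimately have "infdist 0 (frontier H) \<le> dist 0 (- 1 / 2 :: complex)"
    by (intro infdist_le) (simp add: frontier_def)
  thus ?thesis
    by (simp add: bdist_def harm_def half_plane_map_image half_plane_map_def[of 0] H_def dist_norm)
qed

text \<open>The map is \<open>z\<close> times the geometric series, and uniqueness of power series
  expansions identifies the coefficients.\<close>

lemma half_plane_map_tcoeff:
  assumes "n \<ge> 1"
  shows "tcoeff half_plane_map n = 1"
proof -
  define A :: "nat \<Rightarrow> complex" where "A = (\<lambda>k. if k = 0 then 0 else 1)"
  have "(\<lambda>k. A k * z ^ k) sums half_plane_map z" if z: "z \<in> ball 0 1" for z
  proof -
    have "(\<lambda>k. z * z ^ k) sums (z * (1 / (1 - z)))"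
      using z by (intro sums_mult geometric_sums) simp
    hence "(\<lambda>k. A (Suc k) * z ^ Suc k) sums half_plane_map z"
      by (simp add: A_def half_plane_map_def)
    thus ?thesis by (subst (asm) sums_Suc_iff) (simp add: A_def)
  qed
  hence "\<forall>\<^sub>F z in nhds 0. (\<lambda>k. fps_nth (Abs_fps A) k * z ^ k) sums half_plane_map z"
    using eventually_nhds_in_open[of "ball 0 1" "0::complex"] by (auto elim!: eventually_mono)
  hence "half_plane_map has_fps_expansion Abs_fps A" by (rule has_fps_expansionI)
  from fps_nth_fps_expansion[OF this, of n] have "tcoeff half_plane_map n = A n"
    by (simp add: tcoeff_def)
  thus ?thesis using assms by (simp add: A_def)
qed

lemma half_plane_map_Mf:
  assumes \<rho>: "0 \<le> \<rho>" "\<rho> < 1"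
  shows "Mf half_plane_map (\<lambda>z. 0) \<rho> = \<rho> / (1 - \<rho>)"
proof -
  have "tcoeff (\<lambda>z. 0) n = 0" for n by (simp add: tcoeff_def)
  hence "Mf half_plane_map (\<lambda>z. 0) \<rho> = \<rho> + \<rho>\<^sup>2 / (1 - \<rho>)"
    unfolding sums_unique[OF geometric_tail_sums[OF \<rho>]] by (simp add: Mf_def half_plane_map_tcoeff)
  thus ?thesis using \<rho> by (simp add: field_simps power2_eq_square)
qed

lemma schwarzB_power:
  assumes "m \<ge> 1"
  shows "schwarzB m (\<lambda>z. z ^ m)"
proof -
  \<comment> \<open>For \<open>k < m\<close> the power of 0 vanishes; at \<open>k = m\<close> it is
    1 and the Pochhammer factor is the factorial of \<open>m\<close>.\<close>
  have D: "(deriv ^^ k) (\<lambda>z. z ^ m) (0::complex) = pochhammer (of_nat (Suc m - k)) k * 0 ^ (m - k)" for k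
    using higher_deriv_power[of k 0 m 0] by simp
  have "norm (z ^ m) \<le> 1" if "z \<in> ball 0 1" for z :: complex
    using that by (simp add: norm_power power_le_one)
  thus ?thesis
    by (auto simp: schwarzB_def D pochhammer_fact[symmetric] intro!: holomorphic_intros)
qed

theorem theorem3p2:
  fixes m p :: nat
  assumes "m \<ge> 1" and "p \<ge> 1"
  shows "(\<exists>!r. 0 < r \<and> r < 1 \<and> radius_eq m p r = 0)
    \<and> (\<forall>h g \<omega>m \<omega>p z. in_SH0 h g \<and> stable_convex h g \<and> schwarzB m \<omega>m \<and> schwarzB p \<omega>p
         \<and> norm z \<le> r2 m p \<longrightarrow>
           norm (Dop h g (\<omega>m z)) + Mf h g (norm (\<omega>p z)) \<le> bdist h g
         \<and> norm (Dscr h g (\<omega>m z)) + Mf h g (norm (\<omega>p z)) \<le> bdist h g)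
    \<and> (\<forall>r. r2 m p < r \<and> r < 1 \<longrightarrow>
         (\<exists>h g \<omega>m \<omega>p z. in_SH0 h g \<and> stable_convex h g \<and> schwarzB m \<omega>m \<and> schwarzB p \<omega>p
            \<and> norm z = r \<and> norm (Dop h g (\<omega>m z)) + Mf h g (norm (\<omega>p z)) > bdist h g)
       \<and> (\<exists>h g \<omega>m \<omega>p z. in_SH0 h g \<and> stable_convex h g \<and> schwarzB m \<omega>m \<and> schwarzB p \<omega>p
            \<and> norm z = r \<and> norm (Dscr h g (\<omega>m z)) + Mf h g (norm (\<omega>p z)) > bdist h g))"
proof (intro conjI ex1_radius_eq assms allI impI)
  fix h g \<omega>m \<omega>p :: "complex \<Rightarrow> complex" and z :: complex
  assume A: "in_SH0 h g \<and> stable_convex h g \<and> schwarzB m \<omega>m \<and> schwarzB p \<omega>p \<and> norm z \<le> r2 m p"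
  then interpret stable_convex_map h g by unfold_locales auto
  show "norm (Dop h g (\<omega>m z)) + Mf h g (norm (\<omega>p z)) \<le> bdist h g"
    and "norm (Dscr h g (\<omega>m z)) + Mf h g (norm (\<omega>p z)) \<le> bdist h g"
    using Dop_Dscr_Mf_le[OF assms, of \<omega>m \<omega>p z] bdist_ge_half A by auto
next
  fix r assume "r2 m p < r \<and> r < 1"
  hence r: "r2 m p < r" "r < 1" "0 < r" using r2_root(1)[OF assms] by auto
  define x y where "x = r ^ m" and "y = r ^ p"
  have xy: "0 \<le> x" "x < 1" "0 \<le> y" "y < 1"
    using r assms by (simp_all add: x_def y_def power_less_one_iff)
  have "radius_eq m p r > 0"
    using radius_eq_strict_mono[OF assms, of "r2 m p" r] r r2_root[OF assms] by simp
  hence gt: "x / (1 - x)\<^sup>2 + y / (1 - y) > 1 / 2"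
    using radius_eq_alt[OF assms, of r] r by (simp add: x_def y_def)
  \<comment> \<open>With \<open>g = 0\<close> the two operators have the same value, and at the
    positive point \<open>r\<close> with monomial Schwarz functions the estimates become equalities:
    the left-hand side is \<open>x / (1 - x)\<^sup>2 + y / (1 - y)\<close>. One witness thus defeats
    both inequalities.\<close>
  let ?h = half_plane_map and ?g = "\<lambda>z::complex. 0::complex"
  have "deriv ?h (of_real x) = 1 / (1 - of_real x)\<^sup>2"
    using xy by (intro half_plane_map_deriv) simp
  hence "deriv ?h (of_real x) = of_real (1 / (1 - x)\<^sup>2)" by simp
  hence D: "norm (Dop ?h ?g (of_real x)) = x / (1 - x)\<^sup>2" "norm (Dscr ?h ?g (of_real x)) = x / (1 - x)\<^sup>2"
    using xy by (simp_all add: Dop_def Dscr_def norm_mult norm_divide del: of_real_divide of_real_power)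
  have pow: "of_real r ^ m = (of_real x :: complex)" "norm (of_real r ^ p :: complex) = y"
    using r by (simp_all add: x_def y_def norm_power)
  note props = half_plane_map_in_SH0 half_plane_map_stable_convex schwarzB_power[OF assms(1)]
    schwarzB_power[OF assms(2)]
  have nr: "norm (of_real r :: complex) = r" using r by simp
  have big: "x / (1 - x)\<^sup>2 + Mf ?h ?g y > bdist ?h ?g"
    unfolding half_plane_map_Mf[OF xy(3,4)] using half_plane_map_bdist gt by linarith
  show "\<exists>h g \<omega>m \<omega>p z. in_SH0 h g \<and> stable_convex h g \<and> schwarzB m \<omega>m \<and> schwarzB p \<omega>p
      \<and> norm z = r \<and> norm (Dop h g (\<omega>m z)) + Mf h g (norm (\<omega>p z)) > bdist h g"
    by (intro exI[of _ ?h] exI[of _ ?g] exI[of _ "\<lambda>z. z ^ m"] exI[of _ "\<lambda>z. z ^ p"]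
        exI[of _ "of_real r"] conjI props nr) (simp only: pow D big)
  show "\<exists>h g \<omega>m \<omega>p z. in_SH0 h g \<and> stable_convex h g \<and> schwarzB m \<omega>m \<and> schwarzB p \<omega>p
      \<and> norm z = r \<and> norm (Dscr h g (\<omega>m z)) + Mf h g (norm (\<omega>p z)) > bdist h g"
    by (intro exI[of _ ?h] exI[of _ ?g] exI[of _ "\<lambda>z. z ^ m"] exI[of _ "\<lambda>z. z ^ p"]
        exI[of _ "of_real r"] conjI props nr) (simp only: pow D big)
qed

end
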